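(* Let $s\ge 1$ and $k\ge s$ be integers, and let $t_1,\dots,t_k$ be any choice of pairwise distinct real abscissae ($s$ of which, the fundamental abscissae, lie in $(0,1]$) such that the interpolatory quadrature formula $\sum_{i=1}^k\omega_i\, p(t_i)$ with weights $\omega_1,\dots,\omega_k$ satisfies $\sum_{i=1}^k \omega_i\,p(t_i)=\int_0^1 p(t)\,\mathrm{d}t$ for all polynomials $p$ of degree at most $2s-1$. Let $A=\mathcal{I}_s\mathcal{P}_s^T\Omega\in\mathbb{R}^{k\times k}$ be the matrix of the Butcher tableau of the corresponding HBVM$(k,s)$ method. Then the nonzero eigenvalues of $A$ coincide with the eigenvalues of the matrix $A^{G}\in\mathbb{R}^{s\times s}$ of the Butcher tableau of the Gauss-Legendre Runge-Kutta method of order $2s$.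
   Context: Orthonormal basis: for $j\ge 1$, $P_j(t)=\sqrt{2j-1}\,\hat P_{j-1}(t)$, where $\hat P_{j-1}$ is the shifted Legendre polynomial of degree $j-1$ on $[0,1]$ (normalized so that $\hat P_{j-1}(1)=1$). Thus $P_j$ has degree $j-1$ and $\int_0^1 P_i(t)P_j(t)\,\mathrm{d}t=\delta_{ij}$. Weights: given pairwise distinct abscissae $t_1,\dots,t_k$, the weights are $\omega_i=\int_0^1\prod_{j=1,\,j\neq i}^k\frac{t-t_j}{t_i-t_j}\,\mathrm{d}t$, $i=1,\dots,k$. Matrices: $\Omega=\mathrm{diag}(\omega_1,\dots,\omega_k)\in\mathbb{R}^{k\times k}$, and $\mathcal{I}_s,\mathcal{P}_s\in\mathbb{R}^{k\times s}$ are given by $(\mathcal{I}_s)_{ij}=\int_0^{t_i}P_j(x)\,\mathrm{d}x$ and $(\mathcal{P}_s)_{ij}=P_j(t_i)$, for $i=1,\dots,k$, $j=1,\dots,s$. The HBVM$(k,s)$ method (Hamiltonian Boundary Value Method with $k$ steps and degree $s$) is the $k$-stage Runge-Kutta method with abscissae $t_i$, weights $\omega_i$ and Butcher matrix $A=\mathcal{I}_s\mathcal{P}_s^T\Omega$. Gauss-Legendre method of order $2s$: the $s$-stage collocation Runge-Kutta method at the zeros $g_1,\dots,g_s\in(0,1)$ of $\hat P_s$; its Butcher matrix is $A^{G}=(a^G_{ij})$ with $a^G_{ij}=\int_0^{g_i}\prod_{l=1,\,l\ne j}^s\frac{x-g_l}{g_j-g_l}\,\mathrm{d}x$. Eigenvalues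 are counted with algebraic multiplicity. *)

theory Defs
  imports "HOL-Analysis.Analysis" "Jordan_Normal_Form.Char_Poly"
begin

text \<open>Integrals are oriented interval integrals, so that the abscissae are allowed to be negative.
  Families \<open>t\<^sub>1, \<dots>, t\<^sub>k\<close> are functions on \<^typ>\<open>nat\<close> that are only used on \<open>{1..k}\<close>, whereas
  the rows and columns of \<^typ>\<open>real mat\<close> are numbered from \<open>0\<close>; hence the \<^const>\<open>Suc\<close> below.\<close>

text \<open>Rodrigues' formula on \<open>[0,1]\<close>: the \<open>n\<close>-th derivative of \<open>(x\<^sup>2 - x)\<^sup>n / n!\<close>.\<close>

definition shifted_legendre :: "nat \<Rightarrow> real poly" where
  "shifted_legendre n = Polynomial.smult (1 / fact n) ((pderiv ^^ n) ([:0, -1, 1:] ^ n))"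

definition legendre_onb :: "nat \<Rightarrow> real poly" where
  "legendre_onb j = Polynomial.smult (sqrt (2 * real j - 1)) (shifted_legendre (j - 1))"

definition lagrange_basis :: "nat \<Rightarrow> (nat \<Rightarrow> real) \<Rightarrow> nat \<Rightarrow> real \<Rightarrow> real" where
  "lagrange_basis k t i x = (\<Prod>j\<in>{1..k} - {i}. (x - t j) / (t i - t j))"

definition quad_weight :: "nat \<Rightarrow> (nat \<Rightarrow> real) \<Rightarrow> nat \<Rightarrow> real" where
  "quad_weight k t i = (LBINT x=0..1. lagrange_basis k t i x)"

definition Omega_mat :: "nat \<Rightarrow> (nat \<Rightarrow> real) \<Rightarrow> real mat" where
  "Omega_mat k t = mat_diag k (\<lambda>i. quad_weight k t (Suc i))"

definition I_mat :: "nat \<Rightarrow> nat \<Rightarrow> (nat \<Rightarrow> real) \<Rightarrow> real mat" where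
  "I_mat k s t = mat k s (\<lambda>(i, j). LBINT x=0..t (Suc i). poly (legendre_onb (Suc j)) x)"

definition P_mat :: "nat \<Rightarrow> nat \<Rightarrow> (nat \<Rightarrow> real) \<Rightarrow> real mat" where
  "P_mat k s t = mat k s (\<lambda>(i, j). poly (legendre_onb (Suc j)) (t (Suc i)))"

definition hbvm_butcher :: "nat \<Rightarrow> nat \<Rightarrow> (nat \<Rightarrow> real) \<Rightarrow> real mat" where
  "hbvm_butcher k s t = I_mat k s t * transpose_mat (P_mat k s t) * Omega_mat k t"

text \<open>The zeros of the shifted Legendre polynomial of degree \<open>s\<close> in increasing order,
  \<open>gauss_node s 1 < \<dots> < gauss_node s s\<close>.\<close>

definition gauss_node :: "nat \<Rightarrow> nat \<Rightarrow> real" where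
  "gauss_node s i = sorted_list_of_set {x. poly (shifted_legendre s) x = 0} ! (i - 1)"

definition gauss_butcher :: "nat \<Rightarrow> real mat" where
  "gauss_butcher s =
     mat s s (\<lambda>(i, j). LBINT x=0..gauss_node s (Suc i). lagrange_basis s (gauss_node s) (Suc j) x)"

text \<open>The complex eigenvalues of a real matrix, with algebraic multiplicity.\<close>

definition eigenvalues_mset :: "real mat \<Rightarrow> complex multiset" where
  "eigenvalues_mset A = proots (char_poly (map_mat complex_of_real A))"

text \<open>The remainder derives from Rodrigues' formula that \<open>shifted_legendre n\<close> has degree \<open>n\<close> and
  value \<open>1\<close> at \<open>1\<close>, that the \<open>legendre_onb j\<close> with \<open>j \<ge> 1\<close> are orthonormal on \<open>[0,1]\<close>, and that
  \<open>gauss_node s\<close> enumerates exactly \<open>s\<close> zeros, all in \<open>(0,1)\<close>.\<close>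

lemma higher_pderiv_root:
  fixes q :: "real poly"
  assumes "m \<le> n"
  shows "\<exists>r. (pderiv ^^ m) ([:-a, 1:] ^ n * q) = [:-a, 1:] ^ (n - m) * r \<and>
             poly r a = fact n / fact (n - m) * poly q a"
  using assms
proof (induction m)
  case 0
  show ?case by (rule exI[of _ q]) simp
next
  case (Suc m)
  then obtain r where r: "(pderiv ^^ m) ([:-a, 1:] ^ n * q) = [:-a, 1:] ^ (n - m) * r"
    "poly r a = fact n / fact (n - m) * poly q a" by auto
  obtain d where d: "n - m = Suc d" "n - Suc m = d" using Suc.prems by (metis Suc_diff_Suc Suc_le_lessD)
  let ?r = "Polynomial.smult (of_nat (Suc d)) r + [:-a, 1:] * pderiv r"
  have pd: "pderiv [:-a, 1:] = 1" by (simp add: pderiv_pCons)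
  have "(pderiv ^^ Suc m) ([:-a, 1:] ^ n * q) = [:-a, 1:] ^ d * ?r"
    unfolding funpow.simps o_def r(1) d(1) pderiv_mult pderiv_power_Suc pd
    by (simp only: mult.right_neutral power_Suc distrib_left mult_smult_left mult_smult_right mult_1_left) (simp only: ac_simps)
  moreover have "poly ?r a = fact n / fact d * poly q a"
    using r(2) unfolding d(1) by (simp add: fact_Suc del: of_nat_Suc)
  ultimately show ?case using d by auto
qed

lemma rodrigues_base_split: "[:0, -1, 1:] ^ n = [:-1, 1:] ^ n * [:-0, 1::real:] ^ n"
  by (simp flip: power_mult_distrib)

lemma poly_shifted_legendre_1: "poly (shifted_legendre n) 1 = 1"
  using higher_pderiv_root[of n n 1 "[:-0, 1:] ^ n"]
  unfolding shifted_legendre_def rodrigues_base_split by auto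

lemma rodrigues_pderiv_ends:
  assumes "m < n"
  shows "poly ((pderiv ^^ m) ([:0, -1, 1::real:] ^ n)) 0 = 0"
    and "poly ((pderiv ^^ m) ([:0, -1, 1::real:] ^ n)) 1 = 0"
proof -
  show "poly ((pderiv ^^ m) ([:0, -1, 1::real:] ^ n)) 1 = 0"
    using higher_pderiv_root[of m n 1 "[:-0, 1:] ^ n"] assms unfolding rodrigues_base_split by (auto simp: poly_power)
  show "poly ((pderiv ^^ m) ([:0, -1, 1::real:] ^ n)) 0 = 0"
    using higher_pderiv_root[of m n 0 "[:-1, 1:] ^ n"] assms unfolding rodrigues_base_split
    by (subst mult.commute) (auto simp: poly_power)
qed


lemma degree_shifted_legendre: "degree (shifted_legendre n) = n"
  by (simp add: shifted_legendre_def degree_higher_pderiv degree_power_eq)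

lemma poly_integral:
  fixes p :: "real poly"
  shows "(LBINT x=a..b. poly (pderiv p) x) = poly p b - poly p a"
  by (rule interval_integral_FTC_finite)
     (auto intro!: continuous_intros poly_DERIV simp: has_real_derivative_iff_has_vector_derivative [symmetric]
           intro: DERIV_subset[OF poly_DERIV])

lemma poly_interval_integrable:
  fixes p :: "real poly"
  assumes "a \<le> b"
  shows "interval_lebesgue_integrable lborel (ereal a) (ereal b) (poly p)"
  using assms by (intro interval_integrable_continuous_on) (auto intro!: continuous_intros)

lemma poly_mult_fun: "poly (p * q) = (\<lambda>x. poly p x * poly q x)"
  by (simp add: fun_eq_iff)

lemma poly_smult_fun: "poly (Polynomial.smult c p) = (\<lambda>x. c * poly p x)"
  by (simp add: fun_eq_iff)

lemma poly_integral_by_parts: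
  fixes p q :: "real poly"
  shows "(LBINT x=0..1. poly (pderiv p * q) x) = poly (p * q) 1 - poly (p * q) 0 - (LBINT x=0..1. poly (p * pderiv q) x)"
proof -
  have "poly (p * q) 1 - poly (p * q) 0 = (LBINT x=0..1. poly (p * pderiv q) x + poly (pderiv p * q) x)"
    using poly_integral[of 0 1 "p * q"] by (simp add: pderiv_mult zero_ereal_def one_ereal_def algebra_simps)
  also have "\<dots> = (LBINT x=0..1. poly (p * pderiv q) x) + (LBINT x=0..1. poly (pderiv p * q) x)"
    using poly_interval_integrable[of 0 1 "p * pderiv q"] poly_interval_integrable[of 0 1 "pderiv p * q"]
    by (intro interval_lebesgue_integral_add) (simp_all add: zero_ereal_def one_ereal_def poly_mult_fun)
  finally show ?thesis by simp
qed

lemma rodrigues_integral_by_parts: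
  assumes "m \<le> n"
  shows "(LBINT x=0..1. poly ((pderiv ^^ n) ([:0, -1, 1:] ^ n) * q) x) =
    (-1) ^ m * (LBINT x=0..1. poly ((pderiv ^^ (n - m)) ([:0, -1, 1:] ^ n) * (pderiv ^^ m) q) x)"
  using assms
proof (induction m)
  case (Suc m)
  obtain d where d: "n - m = Suc d" "n - Suc m = d" "d < n" using Suc.prems
    by (metis Suc_diff_Suc Suc_le_lessD diff_less zero_less_Suc less_le_trans)
  have "(LBINT x=0..1. poly ((pderiv ^^ (n - m)) ([:0, -1, 1:] ^ n) * (pderiv ^^ m) q) x)
     = - (LBINT x=0..1. poly ((pderiv ^^ d) ([:0, -1, 1:] ^ n) * (pderiv ^^ Suc m) q) x)"
    unfolding d funpow.simps o_def poly_integral_by_parts using rodrigues_pderiv_ends[OF d(3)]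
    by (simp add: poly_mult_fun)
  then show ?case using Suc d by simp
qed simp

lemma shifted_legendre_orth:
  assumes "degree q < n"
  shows "(LBINT x=0..1. poly (shifted_legendre n) x * poly q x) = 0"
proof -
  have "degree ((pderiv ^^ degree q) q) = 0" by (simp add: degree_higher_pderiv)
  then obtain c where "(pderiv ^^ degree q) q = [:c:]" by (auto elim: degree_eq_zeroE)
  then have z1: "(pderiv ^^ Suc (degree q)) q = 0" by (simp add: pderiv_pCons)
  have "(pderiv ^^ j) ((pderiv ^^ Suc (degree q)) q) = 0" for j unfolding z1 by (induction j) auto
  from this[of "n - Suc (degree q)"] have z: "(pderiv ^^ n) q = 0"
    using assms by (simp only: funpow_add[symmetric, THEN fun_cong, unfolded o_def]) simp
  show ?thesis using rodrigues_integral_by_parts[of n n q] by (simp add: z shifted_legendre_def)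
qed

lemma shifted_legendre_norm:
  "(LBINT x=0..1. poly (shifted_legendre n) x * poly (shifted_legendre n) x) = 1 / (2 * n + 1)"
proof -
  define P where "P = shifted_legendre n"
  define X where "X = [:0, 1::real:]"
  define r where "r = X * pderiv P - Polynomial.smult (real n) P"
  have P1: "poly P 1 = 1" and dP: "degree P = n"
    unfolding P_def by (rule poly_shifted_legendre_1, rule degree_shifted_legendre)
  have r0: "r = 0" if "n = 0"
    using that dP by (auto simp: r_def pderiv_eq_0_iff)
  have dr: "degree r < n" if "n > 0"
  proof -
    have "coeff r i = 0" if "i \<ge> n" for i
    proof (cases i)
      case 0 then show ?thesis using that \<open>n > 0\<close> by simp
    next
      case (Suc j)
      then have "coeff r i = (real i - real n) * coeff P i"
        by (simp add: r_def X_def coeff_pderiv algebra_simps)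
      also have "\<dots> = 0" using that dP by (cases "i = n") (auto intro: coeff_eq_0)
      finally show ?thesis .
    qed
    then have "degree r \<le> n - 1" by (intro degree_le) auto
    then show ?thesis using \<open>n > 0\<close> by simp
  qed
  have I0: "(LBINT x=0..1. poly P x * poly r x) = 0"
    using shifted_legendre_orth[OF dr] r0 unfolding P_def by (cases "n = 0") auto
  define J where "J = (LBINT x=0..1. poly (P * P) x)"
  have int: "interval_lebesgue_integrable lborel 0 1 (poly p)" for p :: "real poly"
    using poly_interval_integrable[of 0 1 p] by (simp add: zero_ereal_def one_ereal_def)
  have pX: "pderiv X = 1" by (simp add: X_def pderiv_pCons)
  have "J = (LBINT x=0..1. poly (pderiv X * (P * P)) x)" by (simp add: pX J_def)
  also have "\<dots> = 1 - (LBINT x=0..1. poly (X * pderiv (P * P)) x)"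
    unfolding poly_integral_by_parts by (simp add: P1 X_def poly_mult_fun del: mult_pCons_left)
  also have "(LBINT x=0..1. poly (X * pderiv (P * P)) x) =
     (LBINT x=0..1. 2 * real n * poly (P * P) x + 2 * poly (P * r) x)"
    by (simp add: pderiv_mult r_def algebra_simps)
  also have "\<dots> = (LBINT x=0..1. 2 * real n * poly (P * P) x) + (LBINT x=0..1. 2 * poly (P * r) x)"
    using int[of "Polynomial.smult (2 * real n) (P * P)"] int[of "Polynomial.smult 2 (P * r)"]
    by (intro interval_lebesgue_integral_add) (simp_all add: poly_mult_fun poly_smult_fun)
  also have "\<dots> = 2 * real n * J"
    using I0 by (simp add: J_def)
  finally have "J * (2 * real n + 1) = 1" by (simp add: algebra_simps)
  then show ?thesis by (simp add: J_def P_def field_simps)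
qed

lemma legendre_onb_orthonormal:
  assumes "1 \<le> i" "1 \<le> j"
  shows "(LBINT x=0..1. poly (legendre_onb i) x * poly (legendre_onb j) x) = (if i = j then 1 else 0)"
proof -
  have s: "(LBINT x=0..1. poly (legendre_onb i) x * poly (legendre_onb j) x) =
    sqrt (2 * real i - 1) * sqrt (2 * real j - 1) *
      (LBINT x=0..1. poly (shifted_legendre (i - 1)) x * poly (shifted_legendre (j - 1)) x)"
    unfolding interval_lebesgue_integral_mult_right[symmetric]
    by (simp add: legendre_onb_def mult_ac)
  consider "i = j" | "i < j" | "j < i" by linarith
  then show ?thesis
  proof cases
    case 1
    then show ?thesis using assms unfolding s by (simp add: shifted_legendre_norm of_nat_diff field_simps)
  next
    case 2
    then show ?thesis using assms shifted_legendre_orth[of "shifted_legendre (i - 1)" "j - 1"] unfolding s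
      by (simp add: degree_shifted_legendre mult.commute)
  next
    case 3
    then show ?thesis using assms shifted_legendre_orth[of "shifted_legendre (j - 1)" "i - 1"] unfolding s
      by (simp add: degree_shifted_legendre)
  qed
qed

lemma poly_rolle_zeros:
  fixes p :: "real poly" and f :: "nat \<Rightarrow> real"
  assumes "\<And>i. i \<le> m \<Longrightarrow> poly p (f i) = 0" "\<And>i. i < m \<Longrightarrow> f i < f (Suc i)"
  shows "\<exists>g. \<forall>i<m. f i < g i \<and> g i < f (Suc i) \<and> poly (pderiv p) (g i) = 0"
proof -
  have "\<exists>z. f i < z \<and> z < f (Suc i) \<and> poly (pderiv p) z = 0" if "i < m" for i
  proof -
    have lt: "f i < f (Suc i)" and z: "poly p (f i) = 0" "poly p (f (Suc i)) = 0"
      using assms that by simp_all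
    from poly_MVT[OF lt, of p] obtain z where "f i < z" "z < f (Suc i)"
      "poly p (f (Suc i)) - poly p (f i) = (f (Suc i) - f i) * poly (pderiv p) z" by blast
    with z lt show ?thesis by (intro exI[of _ z]) simp
  qed
  then show ?thesis by (intro choice) blast
qed

lemma rodrigues_higher_zeros:
  assumes "m \<le> n"
  shows "\<exists>f. f 0 = 0 \<and> f (Suc m) = 1 \<and> (\<forall>i\<le>m. f i < f (Suc i)) \<and>
    (\<forall>i\<in>{1..m}. poly ((pderiv ^^ m) ([:0, -1, 1::real:] ^ n)) (f i) = 0)"
  using assms
proof (induction m)
  case 0
  show ?case by (rule exI[of _ real]) simp
next
  case (Suc m)
  define p where "p = (pderiv ^^ m) ([:0, -1, 1::real:] ^ n)"
  from Suc obtain f :: "nat \<Rightarrow> real" where f: "f 0 = 0" "f (Suc m) = 1" "\<forall>i\<le>m. f i < f (Suc i)"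
    "\<forall>i\<in>{1..m}. poly p (f i) = 0" unfolding p_def using Suc_leD by blast
  have "poly p (f i) = 0" if "i \<le> Suc m" for i
  proof -
    have "i = 0 \<or> i \<in> {1..m} \<or> i = Suc m" using that by auto
    then show ?thesis
      using f rodrigues_pderiv_ends[of m n] Suc.prems unfolding p_def by (elim disjE) simp_all
  qed
  then have "\<exists>g. \<forall>i<Suc m. f i < g i \<and> g i < f (Suc i) \<and> poly (pderiv p) (g i) = 0"
    using f(3) by (intro poly_rolle_zeros) simp_all
  then obtain g where g: "\<And>i. i < Suc m \<Longrightarrow> f i < g i \<and> g i < f (Suc i) \<and> poly (pderiv p) (g i) = 0"
    by blast
  define h where "h i = (if i = 0 then 0 else if i = Suc (Suc m) then 1 else g (i - 1))" for i
  have "h i < h (Suc i)" if "i \<le> Suc m" for i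
  proof (cases i)
    case 0
    then show ?thesis using g[of 0] f(1) by (simp add: h_def)
  next
    case (Suc j)
    show ?thesis
    proof (cases "j = m")
      case True
      then show ?thesis using g[of m] f(2) Suc by (simp add: h_def)
    next
      case False
      then show ?thesis using g[of j] g[of "Suc j"] Suc that by (simp add: h_def)
    qed
  qed
  moreover have "poly (pderiv p) (h i) = 0" if "i \<in> {1..Suc m}" for i
  proof -
    have "i - 1 < Suc m" and "i \<noteq> 0" and "i \<noteq> Suc (Suc m)" using that by auto
    then show ?thesis using g[of "i - 1"] by (simp add: h_def)
  qed
  moreover have "h 0 = 0" "h (Suc (Suc m)) = 1" by (simp_all add: h_def)
  ultimately show ?case unfolding p_def funpow.simps o_def by blast
qed

lemma shifted_legendre_zeros:
  "card {x. poly (shifted_legendre n) x = 0} = n"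
  "{x. poly (shifted_legendre n) x = 0} \<subseteq> {0<..<1}"
proof -
  define Z where "Z = {x. poly (shifted_legendre n) x = 0}"
  have nz: "shifted_legendre n \<noteq> 0" using poly_shifted_legendre_1[of n] by auto
  have fin: "finite Z" and le: "card Z \<le> n"
    using poly_roots_finite[OF nz] card_poly_roots_bound[OF nz]
    by (simp_all add: degree_shifted_legendre Z_def)
  obtain f :: "nat \<Rightarrow> real" where f: "f 0 = 0" "f (Suc n) = 1" "\<forall>i\<le>n. f i < f (Suc i)"
    "\<forall>i\<in>{1..n}. poly ((pderiv ^^ n) ([:0, -1, 1::real:] ^ n)) (f i) = 0"
    using rodrigues_higher_zeros[of n n] by blast
  have mono: "f i < f j" if "i < j" "j \<le> Suc n" for i j
    using that
  proof (induction j)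
    case (Suc j)
    have "f j < f (Suc j)" using f(3) Suc.prems by simp
    moreover have "i = j \<or> f i < f j" using Suc by (auto simp: less_Suc_eq)
    ultimately show ?case by (elim disjE) simp_all
  qed simp
  have "inj_on f {1..n}"
    by (rule linorder_inj_onI') (use mono in \<open>simp add: less_imp_neq\<close>)
  then have c: "card (f ` {1..n}) = n" by (simp add: card_image)
  have sub: "f ` {1..n} \<subseteq> Z" using f(4) by (auto simp: shifted_legendre_def Z_def)
  have eq: "f ` {1..n} = Z" by (rule card_seteq[OF fin sub]) (use c le in linarith)
  have "f i \<in> {0<..<1}" if "i \<in> {1..n}" for i
    using mono[of 0 i] mono[of i "Suc n"] that f(1,2) by simp
  then show "{x. poly (shifted_legendre n) x = 0} \<subseteq> {0<..<1}"
    unfolding Z_def[symmetric] eq[symmetric] by (rule image_subsetI)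
  show "card {x. poly (shifted_legendre n) x = 0} = n" 
    using c unfolding eq Z_def .
qed

lemma gauss_node_zeros:
  "strict_mono_on {1..s} (gauss_node s)"
  "gauss_node s ` {1..s} = {x. poly (shifted_legendre s) x = 0}"
proof -
  define Z where "Z = {x. poly (shifted_legendre s) x = 0}"
  define xs where "xs = sorted_list_of_set Z"
  have "shifted_legendre s \<noteq> 0" using poly_shifted_legendre_1[of s] by auto
  then have "finite Z" unfolding Z_def by (rule poly_roots_finite)
  then have xs: "sorted_wrt (<) xs" "set xs = Z" "length xs = s"
    using shifted_legendre_zeros(1)[of s] by (simp_all add: xs_def Z_def strict_sorted_list_of_set)
  have node: "gauss_node s = (\<lambda>i. xs ! (i - 1))"
    by (simp add: fun_eq_iff gauss_node_def xs_def Z_def)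
  show "strict_mono_on {1..s} (gauss_node s)"
    unfolding node strict_mono_on_def
  proof (intro allI impI)
    fix i j assume "i \<in> {1..s} \<and> j \<in> {1..s} \<and> i < j"
    then show "xs ! (i - 1) < xs ! (j - 1)"
      using xs by (intro sorted_wrt_nth_less[OF xs(1)]) auto
  qed
  have "(\<lambda>i. i - 1) ` {1..s} = {..<s}"
  proof
    show "{..<s} \<subseteq> (\<lambda>i. i - 1) ` {1..s}"
    proof
      fix i assume "i \<in> {..<s}"
      then show "i \<in> (\<lambda>i. i - 1) ` {1..s}" by (intro image_eqI[of _ _ "Suc i"]) auto
    qed
  qed auto
  then have "gauss_node s ` {1..s} = (!) xs ` {..<s}"
    unfolding node image_image[of "(!) xs" "\<lambda>i. i - 1" "{1..s}", symmetric] by (simp only:)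
  also have "\<dots> = Z" using xs by (auto simp: set_conv_nth)
  finally show "gauss_node s ` {1..s} = {x. poly (shifted_legendre s) x = 0}" by (simp add: Z_def)
qed

end

theory Submission
  imports Defs
begin

text \<open>Both spectra are compared with that of the \<open>s \<times> s\<close> matrix \<open>X\<close> (below:
  \<open>legendre_primitive_mat s\<close>) with the entries \<open>\<integral>\<^sub>0\<^sup>1 P\<^sub>i Q\<^sub>j\<close>, where \<open>Q\<^sub>j\<close> is the primitive of
  \<open>P\<^sub>j\<close> that vanishes at \<open>0\<close>. This matrix does not depend on any abscissae.

  The products \<open>I (P\<^sup>T \<Omega>)\<close> and \<open>(P\<^sup>T \<Omega>) I\<close> have the same nonzero eigenvalues with the same
  multiplicities (\<open>nonzero_eigenvalues_mult_swap\<close>). The first one is the HBVM matrix; the entries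
  of the second one are the quadrature values of \<open>P\<^sub>i Q\<^sub>j\<close>, a polynomial of degree at most
  \<open>(s - 1) + s\<close>, so that by exactness the second one is \<open>X\<close>
  (\<open>quadrature_legendre_primitive_mat\<close>).

  Now let \<open>P\<close> and \<open>I\<close> be formed at the \<open>s\<close> Gauss nodes. By Lagrange interpolation,
  \<open>A\<^sup>G P = I\<close> (\<open>gauss_butcher_P_mat\<close>). On the other hand \<open>Q\<^sub>j\<close> has degree at most \<open>s\<close>, and in its
  expansion in \<open>P\<^sub>1, \<dots>, P\<^bsub>s+1\<^esub>\<close> the last term vanishes at the Gauss nodes, which are the zeros of
  \<open>P\<^bsub>s+1\<^esub>\<close>; hence \<open>P X = I\<close> (\<open>P_mat_legendre_primitive_mat\<close>). Since \<open>P\<close> is nonsingular,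
  \<open>A\<^sup>G = P X P\<^sup>-\<^sup>1\<close> is similar to \<open>X\<close>. Finally \<open>0\<close> is not an eigenvalue of \<open>A\<^sup>G\<close>, because \<open>I\<close>, too,
  is nonsingular: a vector in its kernel yields a polynomial of degree at most \<open>s\<close> that vanishes at
  \<open>0\<close> and at the \<open>s\<close> Gauss nodes.\<close>

section \<open>Integrals of polynomials\<close>

definition poly_primitive :: "real poly \<Rightarrow> real poly" where
  "poly_primitive p = (\<Sum>i\<le>degree p. monom (coeff p i / real (Suc i)) (Suc i))"

lemma pderiv_poly_primitive: "pderiv (poly_primitive p) = p"
  by (simp add: poly_primitive_def pderiv_sum pderiv_monom poly_as_sum_of_monoms del: of_nat_Suc)

lemma poly_poly_primitive_0 [simp]: "poly (poly_primitive p) 0 = 0"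
  by (simp add: poly_primitive_def poly_sum poly_monom)

lemma degree_poly_primitive: "degree (poly_primitive p) \<le> Suc (degree p)"
  unfolding poly_primitive_def
  by (rule degree_sum_le) (auto intro: order_trans[OF degree_monom_le])

lemma integral_poly_eq_primitive:
  "(LBINT x=0..b. poly p x) = poly (poly_primitive p) b" for b :: real
  using poly_integral[of 0 b "poly_primitive p"]
  by (simp add: pderiv_poly_primitive zero_ereal_def)

text \<open>Since the integral is a difference of two values of a primitive, its linearity reduces to that
  of evaluation, whatever the order of the two limits.\<close>

lemma integral_poly_sum:
  fixes a b :: real
  shows "(LBINT x=a..b. poly (\<Sum>j\<in>S. Polynomial.smult (c j) (p j)) x) =
    (\<Sum>j\<in>S. c j * (LBINT x=a..b. poly (p j) x))"
proof -
  let ?q = "\<Sum>j\<in>S. Polynomial.smult (c j) (poly_primitive (p j))"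
  have "pderiv ?q = (\<Sum>j\<in>S. Polynomial.smult (c j) (p j))"
    by (simp add: pderiv_sum pderiv_smult pderiv_poly_primitive)
  moreover have "(LBINT x=a..b. poly (p j) x) =
      poly (poly_primitive (p j)) b - poly (poly_primitive (p j)) a" for j
    using poly_integral[of a b "poly_primitive (p j)"] by (simp add: pderiv_poly_primitive)
  ultimately show ?thesis
    using poly_integral[of a b ?q]
    by (simp only: poly_sum poly_smult sum_subtractf right_diff_distrib)
qed

section \<open>Expansion in the Legendre basis\<close>

lemma degree_legendre_onb: "1 \<le> j \<Longrightarrow> degree (legendre_onb j) = j - 1"
  by (simp add: legendre_onb_def degree_shifted_legendre)

lemma degree_legendre_sum:
  "degree (\<Sum>j<n. Polynomial.smult (c j) (legendre_onb (Suc j))) \<le> n - 1"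
  by (rule degree_sum_le) (auto intro: order_trans[OF degree_smult_le] simp: degree_legendre_onb)

text \<open>The leading coefficients are nonzero, so the top degree can be split off repeatedly.\<close>

lemma legendre_span:
  assumes "degree q < n"
  shows "\<exists>c. q = (\<Sum>j<n. Polynomial.smult (c j) (legendre_onb (Suc j)))"
  using assms
proof (induction n arbitrary: q)
  case (Suc n)
  let ?P = "legendre_onb (Suc n)"
  define a where "a = coeff q n / coeff ?P n"
  define r where "r = q - Polynomial.smult a ?P"
  have dP: "degree ?P = n" by (simp add: degree_legendre_onb)
  have "shifted_legendre n \<noteq> 0" using poly_shifted_legendre_1[of n] by auto
  then have "?P \<noteq> 0" by (simp add: legendre_onb_def)
  then have "coeff ?P n \<noteq> 0" using dP by (metis leading_coeff_0_iff)
  then have rn: "coeff r n = 0" by (simp add: r_def a_def)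
  have rd: "degree r \<le> n"
    unfolding r_def using Suc.prems dP by (intro degree_diff_le) (auto intro: order_trans[OF degree_smult_le])
  have q: "q = r + Polynomial.smult a ?P" by (simp add: r_def)
  have "\<exists>c. r = (\<Sum>j<n. Polynomial.smult (c j) (legendre_onb (Suc j)))"
  proof (cases "n = 0")
    case True
    with rn rd have "r = 0" by (metis leading_coeff_0_iff le_zero_eq)
    with True show ?thesis by simp
  next
    case False
    then have "degree r < n" using rn rd
      by (metis leading_coeff_0_iff le_neq_implies_less degree_0 gr0I)
    then show ?thesis by (rule Suc.IH)
  qed
  then obtain c where "r = (\<Sum>j<n. Polynomial.smult (c j) (legendre_onb (Suc j)))" by blast
  then have "q = (\<Sum>j<Suc n. Polynomial.smult ((c(n := a)) j) (legendre_onb (Suc j)))"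
    by (subst q) (auto intro!: sum.cong)
  then show ?case by blast
qed simp

lemma legendre_coefficient:
  assumes "i < n"
  shows "(LBINT x=0..1. poly (legendre_onb (Suc i)) x *
      poly (\<Sum>j<n. Polynomial.smult (c j) (legendre_onb (Suc j))) x) = c i"
proof -
  have "(LBINT x=0..1. poly (legendre_onb (Suc i)) x *
      poly (\<Sum>j<n. Polynomial.smult (c j) (legendre_onb (Suc j))) x) =
    (LBINT x=ereal 0..ereal 1. poly (\<Sum>j<n. Polynomial.smult (c j)
      (legendre_onb (Suc i) * legendre_onb (Suc j))) x)"
    by (simp add: poly_sum sum_distrib_left mult_ac zero_ereal_def one_ereal_def)
  also have "\<dots> = (\<Sum>j<n. c j * (LBINT x=0..1. poly (legendre_onb (Suc i)) x * poly (legendre_onb (Suc j)) x))"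
    unfolding integral_poly_sum by (simp add: zero_ereal_def one_ereal_def poly_mult_fun)
  also have "\<dots> = (\<Sum>j<n. if j = i then c j else 0)"
    by (intro sum.cong refl) (subst legendre_onb_orthonormal, auto)
  also have "\<dots> = c i" using assms by simp
  finally show ?thesis .
qed

lemma legendre_expansion:
  assumes "degree q < n"
  shows "q = (\<Sum>j<n. Polynomial.smult (LBINT x=0..1. poly (legendre_onb (Suc j)) x * poly q x)
    (legendre_onb (Suc j)))"
proof -
  obtain c where c: "q = (\<Sum>j<n. Polynomial.smult (c j) (legendre_onb (Suc j)))"
    using legendre_span[OF assms] by blast
  have "(LBINT x=0..1. poly (legendre_onb (Suc j)) x * poly q x) = c j" if "j < n" for j
    unfolding c by (rule legendre_coefficient[OF that])
  then have "(\<Sum>j<n. Polynomial.smult (LBINT x=0..1. poly (legendre_onb (Suc j)) x * poly q x)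
      (legendre_onb (Suc j))) = (\<Sum>j<n. Polynomial.smult (c j) (legendre_onb (Suc j)))"
    by (intro sum.cong) auto
  also have "\<dots> = q" by (rule c[symmetric])
  finally show ?thesis by (rule sym)
qed

lemma legendre_independent:
  assumes "(\<Sum>j<n. Polynomial.smult (c j) (legendre_onb (Suc j))) = 0" "i < n"
  shows "c i = 0"
  using legendre_coefficient[OF assms(2), of c] unfolding assms(1) by simp

section \<open>Lagrange interpolation\<close>

definition lagrange_poly :: "nat \<Rightarrow> (nat \<Rightarrow> real) \<Rightarrow> nat \<Rightarrow> real poly" where
  "lagrange_poly k t i = (\<Prod>j\<in>{1..k} - {i}. Polynomial.smult (1 / (t i - t j)) [:- t j, 1:])"

lemma poly_lagrange_poly: "poly (lagrange_poly k t i) x = lagrange_basis k t i x"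
  by (simp add: lagrange_poly_def lagrange_basis_def poly_prod diff_divide_distrib)

lemma degree_lagrange_poly:
  assumes "i \<in> {1..k}"
  shows "degree (lagrange_poly k t i) \<le> k - 1"
proof -
  have "degree (lagrange_poly k t i) \<le>
      (\<Sum>j\<in>{1..k} - {i}. degree (Polynomial.smult (1 / (t i - t j)) [:- t j, 1:]))"
    unfolding lagrange_poly_def by (rule degree_prod_sum_le[OF finite_Diff, unfolded o_def]) simp
  also have "\<dots> \<le> (\<Sum>j\<in>{1..k} - {i}. 1)"
    by (intro sum_mono order_trans[OF degree_smult_le]) simp
  also have "\<dots> = k - 1" using assms by simp
  finally show ?thesis .
qed

lemma lagrange_basis_node:
  assumes "inj_on t {1..k}" "i \<in> {1..k}" "l \<in> {1..k}"
  shows "lagrange_basis k t i (t l) = (if i = l then 1 else 0)"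
proof (cases "i = l")
  case True
  have "(t i - t j) / (t i - t j) = 1" if "j \<in> {1..k} - {i}" for j
    using that assms by (auto simp: inj_on_eq_iff)
  then show ?thesis unfolding lagrange_basis_def True[symmetric] by simp
next
  case False
  then show ?thesis using assms unfolding lagrange_basis_def
    by (auto intro!: prod_zero bexI[of _ l])
qed

lemma lagrange_interpolation:
  assumes "inj_on t {1..k}" "degree p < k"
  shows "p = (\<Sum>j=1..k. Polynomial.smult (poly p (t j)) (lagrange_poly k t j))"
proof (rule poly_eqI_degree[of "t ` {1..k}"])
  fix x assume "x \<in> t ` {1..k}"
  then obtain l where l: "l \<in> {1..k}" "x = t l" by blast
  have "poly (\<Sum>j=1..k. Polynomial.smult (poly p (t j)) (lagrange_poly k t j)) x =
      (\<Sum>j=1..k. poly p (t j) * (if j = l then 1 else 0))"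
    unfolding poly_sum poly_smult poly_lagrange_poly l(2)
    by (intro sum.cong refl) (use assms l in \<open>simp add: lagrange_basis_node\<close>)
  also have "\<dots> = poly p x" using l by (simp add: if_distrib cong: if_cong)
  finally show "poly p x = poly (\<Sum>j=1..k. Polynomial.smult (poly p (t j)) (lagrange_poly k t j)) x"
    by simp
next
  have "degree (\<Sum>j=1..k. Polynomial.smult (poly p (t j)) (lagrange_poly k t j)) \<le> k - 1"
    by (rule degree_sum_le[OF finite_atLeastAtMost order_trans[OF degree_smult_le degree_lagrange_poly]])
  then show "degree (\<Sum>j=1..k. Polynomial.smult (poly p (t j)) (lagrange_poly k t j)) < card (t ` {1..k})"
    using assms by (simp add: card_image)
qed (use assms in \<open>simp add: card_image\<close>)

section \<open>Nonzero eigenvalues of a product\<close>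

lemma char_poly_matrix_as_diff:
  assumes "A \<in> carrier_mat n n"
  shows "char_poly_matrix A = [:0, 1:] \<cdot>\<^sub>m 1\<^sub>m n - map_mat (\<lambda>a. [:a:]) A"
  using assms by (intro eq_matI) (auto simp: char_poly_matrix_def)

text \<open>Sylvester's determinant identity. Multiplying the block matrix \<open>M\<close> with the rows \<open>(x, A)\<close> and
  \<open>(B, 1)\<close> by a block triangular matrix from the right or from the left makes it block
  triangular; the two resulting values of \<open>det M\<close> involve \<open>A B\<close> and \<open>B A\<close>, respectively.\<close>

lemma char_poly_mult_swap:
  fixes A :: "'a :: idom mat"
  assumes A: "A \<in> carrier_mat n m" and B: "B \<in> carrier_mat m n"
  shows "[:0, 1:] ^ m * char_poly (A * B) = [:0, 1:] ^ n * char_poly (B * A)"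
proof -
  let ?x = "[:0, 1:] :: 'a poly"
  interpret h: comm_ring_hom "\<lambda>a :: 'a. [:a:]" by unfold_locales auto
  define a b where "a = map_mat (\<lambda>a. [:a:]) A" and "b = map_mat (\<lambda>a. [:a:]) B"
  have a: "a \<in> carrier_mat n m" and b: "b \<in> carrier_mat m n" using A B by (auto simp: a_def b_def)
  note [simp] = a b
  have AB: "char_poly (A * B) = det (?x \<cdot>\<^sub>m 1\<^sub>m n - a * b)"
    using char_poly_matrix_as_diff[of "A * B" n] A B
    by (simp add: char_poly_def a_def b_def h.mat_hom_mult)
  have BA: "char_poly (B * A) = det (?x \<cdot>\<^sub>m 1\<^sub>m m - b * a)"
    using char_poly_matrix_as_diff[of "B * A" m] A B
    by (simp add: char_poly_def a_def b_def h.mat_hom_mult)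
  define M where "M = four_block_mat (?x \<cdot>\<^sub>m 1\<^sub>m n) a b (1\<^sub>m m)"
  define L where "L = four_block_mat (1\<^sub>m n) (0\<^sub>m n m) (- b) (?x \<cdot>\<^sub>m 1\<^sub>m m)"
  define R where "R = four_block_mat (1\<^sub>m n) (0\<^sub>m n m) (- b) (1\<^sub>m m)"
  have M: "M \<in> carrier_mat (n + m) (n + m)" and L: "L \<in> carrier_mat (n + m) (n + m)"
    and R: "R \<in> carrier_mat (n + m) (n + m)" by (auto simp: M_def L_def R_def)
  have dL: "det L = ?x ^ m" unfolding L_def
    by (subst det_four_block_mat_upper_right_zero[of _ n _ m]) auto
  have dR: "det R = 1" unfolding R_def
    by (subst det_four_block_mat_upper_right_zero[of _ n _ m]) auto
  have "M * R = four_block_mat (?x \<cdot>\<^sub>m 1\<^sub>m n * 1\<^sub>m n + a * (- b)) (?x \<cdot>\<^sub>m 1\<^sub>m n * 0\<^sub>m n m + a * 1\<^sub>m m)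
      (b * 1\<^sub>m n + 1\<^sub>m m * (- b)) (b * 0\<^sub>m n m + 1\<^sub>m m * 1\<^sub>m m)"
    unfolding M_def R_def by (rule mult_four_block_mat[of _ n n _ m _ m]) auto
  also have "\<dots> = four_block_mat (?x \<cdot>\<^sub>m 1\<^sub>m n - a * b) a (0\<^sub>m m n) (1\<^sub>m m)"
  proof (rule cong_four_block_mat)
    show "?x \<cdot>\<^sub>m 1\<^sub>m n * 1\<^sub>m n + a * (- b) = ?x \<cdot>\<^sub>m 1\<^sub>m n - a * b"
      using carrier_matD[OF a] carrier_matD[OF b]
      by (simp add: add_uminus_minus_mat[of _ n n] mult_carrier_mat[OF a b])
    show "?x \<cdot>\<^sub>m 1\<^sub>m n * 0\<^sub>m n m + a * 1\<^sub>m m = a"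
      using a by (simp add: right_mult_one_mat[OF a])
    show "b * 1\<^sub>m n + 1\<^sub>m m * (- b) = 0\<^sub>m m n"
      using b by (simp add: right_mult_one_mat[OF b] left_mult_one_mat[of _ m n] add_uminus_minus_mat[of _ m n])
    show "b * 0\<^sub>m n m + 1\<^sub>m m * 1\<^sub>m m = 1\<^sub>m m"
      using b by (simp add: right_mult_zero_mat[OF b])
  qed
  finally have "det (M * R) = det (?x \<cdot>\<^sub>m 1\<^sub>m n - a * b)"
    by (simp add: det_four_block_mat_lower_left_zero[of _ n _ m]
        minus_carrier_mat[OF mult_carrier_mat[OF a b]])
  then have 1: "det M = char_poly (A * B)"
    by (simp add: AB det_mult[OF M R] dR)
  have "L * M = four_block_mat (1\<^sub>m n * (?x \<cdot>\<^sub>m 1\<^sub>m n) + 0\<^sub>m n m * b) (1\<^sub>m n * a + 0\<^sub>m n m * 1\<^sub>m m)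
      (- b * (?x \<cdot>\<^sub>m 1\<^sub>m n) + ?x \<cdot>\<^sub>m 1\<^sub>m m * b) (- b * a + ?x \<cdot>\<^sub>m 1\<^sub>m m * 1\<^sub>m m)"
    unfolding M_def L_def by (rule mult_four_block_mat[of _ n n _ m _ m]) auto
  also have "\<dots> = four_block_mat (?x \<cdot>\<^sub>m 1\<^sub>m n) a (0\<^sub>m m n) (?x \<cdot>\<^sub>m 1\<^sub>m m - b * a)"
  proof (rule cong_four_block_mat)
    show "1\<^sub>m n * (?x \<cdot>\<^sub>m 1\<^sub>m n) + 0\<^sub>m n m * b = ?x \<cdot>\<^sub>m 1\<^sub>m n"
      by (simp add: left_mult_zero_mat[OF b])
    show "1\<^sub>m n * a + 0\<^sub>m n m * 1\<^sub>m m = a"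
      using a by (simp add: left_mult_one_mat[OF a])
    show "- b * (?x \<cdot>\<^sub>m 1\<^sub>m n) + ?x \<cdot>\<^sub>m 1\<^sub>m m * b = 0\<^sub>m m n"
    proof -
      have nb: "- b \<in> carrier_mat m n" using b by simp
      show ?thesis
        unfolding mult_smult_distrib[OF nb one_carrier_mat] mult_smult_assoc_mat[OF one_carrier_mat b]
          right_mult_one_mat[OF nb] left_mult_one_mat[OF b]
        using carrier_matD[OF b] by (intro eq_matI) auto
    qed
    show "- b * a + ?x \<cdot>\<^sub>m 1\<^sub>m m * 1\<^sub>m m = ?x \<cdot>\<^sub>m 1\<^sub>m m - b * a"
      using carrier_matD[OF a] carrier_matD[OF b] by (intro eq_matI) auto
  qed
  finally have "det (L * M) = ?x ^ n * char_poly (B * A)"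
    by (simp add: det_four_block_mat_lower_left_zero[of _ n _ m] BA
        minus_carrier_mat[OF mult_carrier_mat[OF b a]])
  with 1 show ?thesis by (simp add: det_mult[OF L M] dL)
qed

lemma eigenvalues_mset_real:
  assumes "A \<in> carrier_mat n n"
  shows "eigenvalues_mset A = proots (map_poly complex_of_real (char_poly A))"
  unfolding eigenvalues_mset_def by (simp add: of_real_hom.char_poly_hom[OF assms])

lemma nonzero_eigenvalues_mult_swap:
  assumes A: "A \<in> carrier_mat n m" and B: "B \<in> carrier_mat m n"
  shows "filter_mset (\<lambda>z. z \<noteq> 0) (eigenvalues_mset (A * B)) =
    filter_mset (\<lambda>z. z \<noteq> 0) (eigenvalues_mset (B * A))"
proof -
  let ?c = "map_poly complex_of_real"
  let ?nz = "filter_mset (\<lambda>z :: complex. z \<noteq> 0)"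
  interpret c: map_poly_comm_ring_hom complex_of_real ..
  have carr: "A * B \<in> carrier_mat n n" "B * A \<in> carrier_mat m m" using A B by auto
  have nz: "?c (char_poly M) \<noteq> 0" if "M \<in> carrier_mat d d" for M d
    using degree_monic_char_poly[OF that] by auto
  \<comment> \<open>A factor \<open>x ^ d\<close> only contributes roots \<open>0\<close>.\<close>
  have drop: "?nz (proots ([:0, 1:] ^ d * p)) = ?nz (proots p)" if "p \<noteq> 0" for d and p :: "complex poly"
  proof -
    have "?nz (repeat_mset d {#0#}) = {#}" by (induction d) auto
    then show ?thesis using that by (simp add: proots_mult proots_power)
  qed
  have "?c ([:0, 1:] ^ m * char_poly (A * B)) = ?c ([:0, 1:] ^ n * char_poly (B * A))"
    by (simp only: char_poly_mult_swap[OF A B])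
  then have "[:0, 1:] ^ m * ?c (char_poly (A * B)) = [:0, 1:] ^ n * ?c (char_poly (B * A))"
    by (simp add: c.hom_mult c.hom_power del: mult_pCons_left)
  then show ?thesis
    using drop[OF nz[OF carr(1)], of m] drop[OF nz[OF carr(2)], of n]
    by (simp add: eigenvalues_mset_real[OF carr(1)] eigenvalues_mset_real[OF carr(2)])
qed

lemma eigenvalues_mset_nonsingular:
  assumes A: "A \<in> carrier_mat n n" and "det A \<noteq> 0"
  shows "filter_mset (\<lambda>z. z \<noteq> 0) (eigenvalues_mset A) = eigenvalues_mset A"
proof -
  have nz: "map_poly complex_of_real (char_poly A) \<noteq> 0"
    using degree_monic_char_poly[OF A] by auto
  have "\<not> eigenvalue A 0"
  proof
    assume "eigenvalue A 0"
    then obtain v where "v \<in> carrier_vec n" "v \<noteq> 0\<^sub>v n" "A *\<^sub>v v = 0 \<cdot>\<^sub>v v"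
      using A by (auto simp: eigenvalue_def eigenvector_def)
    moreover from this(1) have "0 \<cdot>\<^sub>v v = 0\<^sub>v n" by auto
    ultimately show False using assms(2) det_0_iff_vec_prod_zero_field[OF A] by auto
  qed
  then have "poly (char_poly A) 0 \<noteq> 0" using eigenvalue_root_char_poly[OF A] by simp
  then have "poly (map_poly complex_of_real (char_poly A)) 0 \<noteq> 0" 
    by (simp add: poly_0_coeff_0 coeff_map_poly)
  then show ?thesis 
    using nz by (auto simp: eigenvalues_mset_real[OF A] filter_mset_eq_conv)
qed

section \<open>Matrices at the Gauss nodes\<close>

lemma inj_on_gauss_node: "inj_on (gauss_node s) {1..s}"
  by (rule strict_mono_on_imp_inj_on[OF gauss_node_zeros(1)])

lemma card_gauss_nodes: "card (gauss_node s ` {1..s}) = s"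
  by (simp only: card_image[OF inj_on_gauss_node] card_atLeastAtMost)

lemma I_mat_eq_primitive:
  "I_mat k s t = Matrix.mat k s (\<lambda>(i, j). poly (poly_primitive (legendre_onb (Suc j))) (t (Suc i)))"
  by (simp add: I_mat_def integral_poly_eq_primitive)

text \<open>A kernel vector is the list of Legendre coefficients of a polynomial of degree less than \<open>s\<close>
  with \<open>s\<close> zeros.\<close>

lemma P_mat_gauss_nonsingular: "det (P_mat s s (gauss_node s)) \<noteq> 0"
proof
  let ?g = "gauss_node s"
  assume "det (P_mat s s ?g) = 0"
  then obtain v where v: "v \<in> carrier_vec s" "v \<noteq> 0\<^sub>v s" "P_mat s s ?g *\<^sub>v v = 0\<^sub>v s"
    using det_0_iff_vec_prod_zero_field[of "P_mat s s ?g" s] by (auto simp: P_mat_def)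
  define p where "p = (\<Sum>j<s. Polynomial.smult (v $ j) (legendre_onb (Suc j)))"
  have root: "poly p (?g (Suc i)) = 0" if "i < s" for i
  proof -
    have "(P_mat s s ?g *\<^sub>v v) $ i = 0" using v(3) that by simp
    then show ?thesis using that v(1)
      by (simp add: P_mat_def p_def poly_sum scalar_prod_def atLeast0LessThan mult.commute)
  qed
  have "s > 0" using v(1,2) by (cases s) auto
  have "p = 0"
  proof (rule poly_eqI_degree[of "?g ` {1..s}"])
    fix x assume "x \<in> ?g ` {1..s}"
    then obtain l where "l \<in> {1..s}" "x = ?g l" by blast
    then show "poly p x = poly 0 x" using root[of "l - 1"] by (cases l) auto
  qed (use degree_legendre_sum[where n=s and c="vec_index v"] \<open>s > 0\<close>
       in \<open>unfold card_gauss_nodes p_def, simp_all\<close>)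
  then have "v $ j = 0" if "j < s" for j
    using legendre_independent[where n=s and c="vec_index v" and i=j] that by (simp add: p_def)
  then show False using v(1,2) by (auto intro: eq_vecI)
qed

text \<open>A kernel vector \<open>v\<close> gives the polynomial \<open>q = \<Sum> v\<^sub>j Q\<^sub>j\<close> of degree at most \<open>s\<close>, which vanishes at
  the Gauss nodes and, as its terms are primitives based at \<open>0\<close>, also at \<open>0\<close>. These \<open>s + 1\<close> zeros
  are distinct since the nodes are positive, so \<open>q\<close> and with it \<open>q' = \<Sum> v\<^sub>j P\<^sub>j\<close> vanish.\<close>

lemma I_mat_gauss_nonsingular: "det (I_mat s s (gauss_node s)) \<noteq> 0"
proof
  let ?g = "gauss_node s"
  assume "det (I_mat s s ?g) = 0"
  then obtain v where v: "v \<in> carrier_vec s" "v \<noteq> 0\<^sub>v s" "I_mat s s ?g *\<^sub>v v = 0\<^sub>v s"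
    using det_0_iff_vec_prod_zero_field[of "I_mat s s ?g" s] by (auto simp: I_mat_def)
  define q where "q = (\<Sum>j<s. Polynomial.smult (v $ j) (poly_primitive (legendre_onb (Suc j))))"
  have root: "poly q (?g (Suc i)) = 0" if "i < s" for i
  proof -
    have "(I_mat s s ?g *\<^sub>v v) $ i = 0" using v(3) that by simp
    then show ?thesis using that v(1)
      by (simp add: I_mat_eq_primitive q_def poly_sum scalar_prod_def atLeast0LessThan mult.commute)
  qed
  have "degree q \<le> s" unfolding q_def
    by (rule degree_sum_le)
       (auto intro!: order_trans[OF degree_smult_le] order_trans[OF degree_poly_primitive]
             simp: degree_legendre_onb)
  moreover have "0 \<notin> ?g ` {1..s}"
    using shifted_legendre_zeros(2)[of s] unfolding gauss_node_zeros(2) by auto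
  then have "card (insert 0 (?g ` {1..s})) = Suc s"
    using card_gauss_nodes[of s] by simp
  moreover have "poly q x = poly 0 x" if "x \<in> insert 0 (?g ` {1..s})" for x
  proof (cases "x = 0")
    case True
    then show ?thesis by (simp add: q_def poly_sum)
  next
    case False
    then obtain l where "l \<in> {1..s}" "x = ?g l" using \<open>x \<in> _\<close> by blast
    then show ?thesis using root[of "l - 1"] by (cases l) auto
  qed
  ultimately have "q = 0" by (intro poly_eqI_degree[of "insert 0 (?g ` {1..s})"]) auto
  then have "pderiv q = 0" by simp
  then have "(\<Sum>j<s. Polynomial.smult (v $ j) (legendre_onb (Suc j))) = 0"
    by (simp add: q_def pderiv_sum pderiv_smult pderiv_poly_primitive)
  then have "v $ j = 0" if "j < s" for j
    using legendre_independent[where n=s and c="vec_index v" and i=j] that by simp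
  then show False using v(1,2) by (auto intro: eq_vecI)
qed

text \<open>The collocation matrix integrates exactly every polynomial that agrees with its interpolant at
  the Gauss nodes, in particular every \<open>P\<^sub>j\<close> with \<open>j \<le> s\<close>.\<close>

lemma gauss_butcher_P_mat: "gauss_butcher s * P_mat s s (gauss_node s) = I_mat s s (gauss_node s)"
proof (rule eq_matI)
  let ?g = "gauss_node s"
  fix i j assume "i < dim_row (I_mat s s ?g)" "j < dim_col (I_mat s s ?g)"
  then have ij: "i < s" "j < s" by (simp_all add: I_mat_def)
  let ?p = "legendre_onb (Suc j)"
  have deg: "degree ?p < s" using ij by (simp add: degree_legendre_onb)
  have "(LBINT x=0..?g (Suc i). poly ?p x) =
    (LBINT x=ereal 0..ereal (?g (Suc i)).
      poly (\<Sum>l=1..s. Polynomial.smult (poly ?p (?g l)) (lagrange_poly s ?g l)) x)"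
    using lagrange_interpolation[OF inj_on_gauss_node deg] by (simp add: zero_ereal_def)
  also have "\<dots> = (\<Sum>l=1..s. poly ?p (?g l) * (LBINT x=0..?g (Suc i). lagrange_basis s ?g l x))"
    unfolding integral_poly_sum poly_lagrange_poly by (simp add: zero_ereal_def)
  finally show "(gauss_butcher s * P_mat s s ?g) $$ (i, j) = I_mat s s ?g $$ (i, j)"
    using ij
    by (simp add: gauss_butcher_def P_mat_def I_mat_def scalar_prod_def atLeast0LessThan
          sum.atLeast1_atMost_eq mult.commute)
qed (simp_all add: gauss_butcher_def P_mat_def I_mat_def)

text \<open>The matrix, in the basis \<open>P\<^sub>1, \<dots>, P\<^sub>s\<close>, of the operator \<open>p \<mapsto> \<integral>\<^sub>0\<^sup>x p\<close> followed by the
  orthogonal projection onto the polynomials of degree less than \<open>s\<close>.\<close>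

definition legendre_primitive_mat :: "nat \<Rightarrow> real mat" where
  "legendre_primitive_mat s = Matrix.mat s s (\<lambda>(i, j).
     LBINT x=0..1. poly (legendre_onb (Suc i)) x * poly (poly_primitive (legendre_onb (Suc j))) x)"

text \<open>In the Legendre expansion of \<open>Q\<^sub>j\<close>, which has the terms \<open>P\<^sub>1, \<dots>, P\<^bsub>s+1\<^esub>\<close>, the term with
  \<open>P\<^bsub>s+1\<^esub>\<close> drops out at the Gauss nodes.\<close>

lemma P_mat_legendre_primitive_mat:
  "P_mat s s (gauss_node s) * legendre_primitive_mat s = I_mat s s (gauss_node s)"
proof (rule eq_matI)
  let ?g = "gauss_node s"
  fix i j assume "i < dim_row (I_mat s s ?g)" "j < dim_col (I_mat s s ?g)"
  then have ij: "i < s" "j < s" by (simp_all add: I_mat_def)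
  let ?q = "poly_primitive (legendre_onb (Suc j))"
  let ?c = "\<lambda>l. LBINT x=0..1. poly (legendre_onb (Suc l)) x * poly ?q x"
  have deg: "degree ?q < Suc s"
    using degree_poly_primitive[of "legendre_onb (Suc j)"] ij by (simp add: degree_legendre_onb)
  have "?g (Suc i) \<in> ?g ` {1..s}" using ij by auto
  then have "poly (legendre_onb (Suc s)) (?g (Suc i)) = 0"
    unfolding gauss_node_zeros(2) by (simp add: legendre_onb_def)
  moreover have "poly ?q (?g (Suc i)) = (\<Sum>l<Suc s. ?c l * poly (legendre_onb (Suc l)) (?g (Suc i)))"
    using arg_cong[OF legendre_expansion[OF deg], of "\<lambda>p. poly p (?g (Suc i))"]
    unfolding poly_sum poly_smult .
  ultimately show "(P_mat s s ?g * legendre_primitive_mat s) $$ (i, j) = I_mat s s ?g $$ (i, j)"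
    using ij
    by (simp add: P_mat_def legendre_primitive_mat_def I_mat_eq_primitive scalar_prod_def
          atLeast0LessThan mult.commute)
qed (simp_all add: P_mat_def legendre_primitive_mat_def I_mat_def)

lemma similar_gauss_butcher: "similar_mat (gauss_butcher s) (legendre_primitive_mat s)"
proof -
  let ?A = "gauss_butcher s" and ?P = "P_mat s s (gauss_node s)" and ?X = "legendre_primitive_mat s"
  have carr: "?A \<in> carrier_mat s s" "?P \<in> carrier_mat s s" "?X \<in> carrier_mat s s"
    by (simp_all add: gauss_butcher_def P_mat_def legendre_primitive_mat_def)
  obtain Q where Q: "Q \<in> carrier_mat s s" "?P * Q = 1\<^sub>m s" "Q * ?P = 1\<^sub>m s"
    using det_non_zero_imp_unit[OF carr(2) P_mat_gauss_nonsingular]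
    by (auto simp: Units_def ring_mat_def)
  have "?A = ?A * (?P * Q)" using Q carr by simp
  also have "\<dots> = ?A * ?P * Q" using Q carr by (simp add: assoc_mult_mat[of _ s s _ s _ s])
  also have "\<dots> = ?P * ?X * Q" by (simp add: gauss_butcher_P_mat P_mat_legendre_primitive_mat)
  finally show ?thesis using Q carr by (intro similar_matI[of _ _ ?P Q s]) auto
qed

text \<open>Determinants in \<open>A\<^sup>G P = I\<close>.\<close>

lemma gauss_butcher_nonsingular: "det (gauss_butcher s) \<noteq> 0"
proof -
  have "det (gauss_butcher s) * det (P_mat s s (gauss_node s)) = det (I_mat s s (gauss_node s))"
    unfolding gauss_butcher_P_mat[symmetric]
    by (rule det_mult[symmetric]) (auto simp: gauss_butcher_def P_mat_def)
  then show ?thesis using I_mat_gauss_nonsingular by auto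
qed

section \<open>The spectrum of the HBVM matrix\<close>

text \<open>The \<open>(i, j)\<close> entry of the left-hand side is the quadrature value of \<open>P\<^sub>i Q\<^sub>j\<close>, whose degree is at
  most \<open>2 s - 1\<close>.\<close>

lemma quadrature_legendre_primitive_mat:
  assumes "\<And>p :: real poly. degree p \<le> 2 * s - 1 \<Longrightarrow>
    (\<Sum>i=1..k. quad_weight k t i * poly p (t i)) = (LBINT x=0..1. poly p x)"
  shows "transpose_mat (P_mat k s t) * Omega_mat k t * I_mat k s t = legendre_primitive_mat s"
proof (rule eq_matI)
  fix i j assume "i < dim_row (legendre_primitive_mat s)" "j < dim_col (legendre_primitive_mat s)"
  then have ij: "i < s" "j < s" by (simp_all add: legendre_primitive_mat_def)
  let ?p = "legendre_onb (Suc i)" and ?q = "poly_primitive (legendre_onb (Suc j))"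
  have "degree (?p * ?q) \<le> i + Suc j"
    using degree_mult_le[of ?p ?q] degree_poly_primitive[of "legendre_onb (Suc j)"]
    by (simp add: degree_legendre_onb)
  then have "(\<Sum>l=1..k. quad_weight k t l * poly (?p * ?q) (t l)) = (LBINT x=0..1. poly (?p * ?q) x)"
    using ij by (intro assms) simp
  then show "(transpose_mat (P_mat k s t) * Omega_mat k t * I_mat k s t) $$ (i, j) =
      legendre_primitive_mat s $$ (i, j)"
    using ij
    by (simp add: Omega_mat_def mat_diag_mult_right[of _ s k] P_mat_def I_mat_eq_primitive
          legendre_primitive_mat_def scalar_prod_def atLeast0LessThan sum.atLeast1_atMost_eq mult_ac)
qed (simp_all add: P_mat_def I_mat_def legendre_primitive_mat_def)

theorem theorem1:
  fixes s k :: nat and t :: "nat \<Rightarrow> real"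
  assumes "1 \<le> s" and "s \<le> k"
    and "inj_on t {1..k}"
    and "\<exists>F \<subseteq> {1..k}. card F = s \<and> t ` F \<subseteq> {0<..1}"
    and "\<And>p :: real poly. degree p \<le> 2 * s - 1 \<Longrightarrow>
           (\<Sum>i=1..k. quad_weight k t i * poly p (t i)) = (LBINT x=0..1. poly p x)"
  shows "filter_mset (\<lambda>z. z \<noteq> 0) (eigenvalues_mset (hbvm_butcher k s t)) =
           eigenvalues_mset (gauss_butcher s)"
proof -
  let ?nz = "filter_mset (\<lambda>z :: complex. z \<noteq> 0)"
  let ?B = "transpose_mat (P_mat k s t) * Omega_mat k t"
  have P: "transpose_mat (P_mat k s t) \<in> carrier_mat s k" and I: "I_mat k s t \<in> carrier_mat k s"
    and W: "Omega_mat k t \<in> carrier_mat k k"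
    by (simp_all add: P_mat_def I_mat_def Omega_mat_def)
  have B: "?B \<in> carrier_mat s k" using P W by simp
  have G: "gauss_butcher s \<in> carrier_mat s s" by (simp add: gauss_butcher_def)
  have X: "legendre_primitive_mat s \<in> carrier_mat s s" by (simp add: legendre_primitive_mat_def)
  have "hbvm_butcher k s t = I_mat k s t * ?B"
    unfolding hbvm_butcher_def by (rule assoc_mult_mat[OF I P W])
  then have "?nz (eigenvalues_mset (hbvm_butcher k s t)) = ?nz (eigenvalues_mset (?B * I_mat k s t))"
    using nonzero_eigenvalues_mult_swap[OF I B] by simp
  also have "?B * I_mat k s t = legendre_primitive_mat s"
    by (rule quadrature_legendre_primitive_mat) (fact assms(5))
  also have "eigenvalues_mset (legendre_primitive_mat s) = eigenvalues_mset (gauss_butcher s)"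
    unfolding eigenvalues_mset_real[OF G] eigenvalues_mset_real[OF X]
    by (simp only: char_poly_similar[OF similar_gauss_butcher])
  also have "?nz \<dots> = \<dots>" by (rule eigenvalues_mset_nonsingular[OF G gauss_butcher_nonsingular])
  finally show ?thesis .
qed

end
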